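(* Let $L$ be a nilpotent symplectic alternating algebra of dimension $2n\geq 2$. There exists an ascending chain of isotropic ideals $$\{0\}=I_{0}<I_{1}<\cdots<I_{n-1}<I_{n}$$ such that $\dim I_{r}=r$ for $r=0,\ldots,n$. Furthermore, for $2n\geq 6$, $I_{n-1}^{\perp}$ is abelian and the ascending chain $$\{0\}<I_{2}<I_{3}<\cdots<I_{n-1}<I_{n-1}^{\perp}<I_{n-2}^{\perp}<\cdots<I_{2}^{\perp}<L$$ is a central chain. In particular (for $2n\geq 6$) $L$ is nilpotent of class at most $2n-3$.
   Context: A symplectic alternating algebra over a field $F$ is a triple $(L,(\ ,\ ),\cdot)$ where $L$ is a finite-dimensional vector space over $F$ with a non-degenerate alternating bilinear form $(\ ,\ )$ and $\cdot$ is a bilinear alternating operation on $L$ (so $u\cdot u=0$ for all $u$) such that $(u\cdot v,w)=(v\cdot w,u)$ for all $u,v,w\in L$. Then $\dim L$ is even. For subspaces $U,V$, $UV$ is the subspace spanned by all products $u\cdot v$ with $u\in U,v\in V$. An ideal is a subspace $I$ with $IL\leq I$; if $I$ is an ideal so is its orthogonal complement $I^{\perp}$ with respect to the form. A subspace is isotropic if the form vanishes on it; an ideal $I$ is abelian if $I\cdot I=\{0\}$. A chain of ideals $J_{0}\leq J_{1}\leq\cdots\leq J_{m}$ is central in $L$ if $J_{s}L\leq J_{s-1}$ for $s=1,\ldots,m$. $L$ is nilpotent if there is a central chain of ideals $\{0\}=J_{0}\leq\cdots\leq J_{m}=L$; the smallest possible $m$ is the nilpotence class of $L$. *)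

theory Defs
  imports Complex_Main
begin

text \<open>The carrier of the algebra is the whole type; \<open>scale\<close>, \<open>form\<close> and \<open>mult\<close> are the scalar
  multiplication, the symplectic form and the algebra product.\<close>

locale symp_alt_algebra = vector_space scale
  for scale :: "'f::field \<Rightarrow> 'v::ab_group_add \<Rightarrow> 'v" +
  fixes form :: "'v \<Rightarrow> 'v \<Rightarrow> 'f"
    and mult :: "'v \<Rightarrow> 'v \<Rightarrow> 'v"
  assumes finite_dim: "\<exists>B. finite_dimensional_vector_space scale B"
    and form_linear_left: "\<And>v. Vector_Spaces.linear scale (*) (\<lambda>u. form u v)"
    and form_linear_right: "\<And>u. Vector_Spaces.linear scale (*) (\<lambda>v. form u v)"
    and form_alternating: "\<And>u. form u u = 0"
    and form_nondegenerate: "\<And>u. (\<And>v. form u v = 0) \<Longrightarrow> u = 0"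
    and mult_linear_left: "\<And>v. Vector_Spaces.linear scale scale (\<lambda>u. mult u v)"
    and mult_linear_right: "\<And>u. Vector_Spaces.linear scale scale (\<lambda>v. mult u v)"
    and mult_alternating: "\<And>u. mult u u = 0"
    and form_mult_cyclic: "\<And>u v w. form (mult u v) w = form (mult v w) u"
begin

definition subspace_prod :: "'v set \<Rightarrow> 'v set \<Rightarrow> 'v set" where
  "subspace_prod U V = span {mult u v | u v. u \<in> U \<and> v \<in> V}"

definition ideal :: "'v set \<Rightarrow> bool" where
  "ideal I \<longleftrightarrow> subspace I \<and> subspace_prod I UNIV \<subseteq> I"

definition abelian_ideal :: "'v set \<Rightarrow> bool" where
  "abelian_ideal I \<longleftrightarrow> ideal I \<and> subspace_prod I I = {0}"

definition perp :: "'v set \<Rightarrow> 'v set" where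
  "perp U = {v. \<forall>u\<in>U. form u v = 0}"

definition isotropic :: "'v set \<Rightarrow> bool" where
  "isotropic U \<longleftrightarrow> subspace U \<and> (\<forall>u\<in>U. \<forall>v\<in>U. form u v = 0)"

text \<open>A chain \<open>J\<^sub>0 \<le> \<dots> \<le> J\<^sub>m\<close> is the list \<open>[J\<^sub>0, \<dots>, J\<^sub>m]\<close>, of length \<open>m + 1\<close>.\<close>

definition central_chain :: "'v set list \<Rightarrow> bool" where
  "central_chain Js \<longleftrightarrow> (\<forall>J\<in>set Js. ideal J) \<and>
     successively (\<lambda>J J'. J \<subseteq> J' \<and> subspace_prod J' UNIV \<subseteq> J) Js"

definition full_central_chain :: "nat \<Rightarrow> 'v set list \<Rightarrow> bool" where
  "full_central_chain m Js \<longleftrightarrow> central_chain Js \<and> length Js = m + 1 \<and>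
     Js ! 0 = {0} \<and> Js ! m = UNIV"

definition nilpotent :: bool where
  "nilpotent \<longleftrightarrow> (\<exists>m Js. full_central_chain m Js)"

definition nilpotence_class :: nat where
  "nilpotence_class = (LEAST m. \<exists>Js. full_central_chain m Js)"

end

end

theory Submission imports Defs begin

text \<open>Everything rests on the trilinear form \<open>(u v, w)\<close> being alternating. The flag is built one
  dimension at a time: for an isotropic ideal \<open>I \<noteq> I\<^sup>\<bottom>\<close>, the lowest term of a central chain that meets
  \<open>I\<^sup>\<bottom>\<close> outside \<open>I\<close> contains a vector \<open>v \<in> I\<^sup>\<bottom> - I\<close> with \<open>v L \<subseteq> I\<close>, and \<open>I + F v\<close> is again an isotropic
  ideal. Thus \<open>I\<^bsub>r+1\<^esub> L \<subseteq> I\<^sub>r\<close>, and dually \<open>I\<^sub>r\<^sup>\<bottom> L \<subseteq> I\<^bsub>r+1\<^esub>\<^sup>\<bottom>\<close>. The three steps saved at the ends and in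
  the middle of the chain come from the alternating property: it kills \<open>I\<^sub>2 L\<close>, and it kills the product
  on \<open>I\<^bsub>n-1\<^esub>\<^sup>\<bottom>\<close>, which is \<open>I\<^sub>n\<close> plus a line.\<close>

context symp_alt_algebra
begin

section \<open>Sign rules for the form and the product\<close>

lemma form_simps:
  "form (u + v) w = form u w + form v w" "form w (u + v) = form w u + form w v"
  "form (scale c u) w = c * form u w" "form w (scale c u) = c * form w u"
  "form 0 w = 0" "form w 0 = 0" "form (- u) w = - form u w"
proof -
  interpret l: Vector_Spaces.linear scale "(*)" "\<lambda>u. form u w" by (rule form_linear_left)
  interpret r: Vector_Spaces.linear scale "(*)" "\<lambda>u. form w u" by (rule form_linear_right)
  show "form (u + v) w = form u w + form v w" "form w (u + v) = form w u + form w v"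
    "form (scale c u) w = c * form u w" "form w (scale c u) = c * form w u"
    "form 0 w = 0" "form w 0 = 0" "form (- u) w = - form u w"
    by (fact l.add r.add l.scale r.scale l.zero r.zero l.neg)+
qed

lemma mult_simps:
  "mult (u + v) w = mult u w + mult v w" "mult w (u + v) = mult w u + mult w v"
  "mult (scale c u) w = scale c (mult u w)" "mult w (scale c u) = scale c (mult w u)"
  "mult 0 w = 0" "mult w 0 = 0"
proof -
  interpret l: Vector_Spaces.linear scale scale "\<lambda>u. mult u w" by (rule mult_linear_left)
  interpret r: Vector_Spaces.linear scale scale "\<lambda>u. mult w u" by (rule mult_linear_right)
  show "mult (u + v) w = mult u w + mult v w" "mult w (u + v) = mult w u + mult w v"
    "mult (scale c u) w = scale c (mult u w)" "mult w (scale c u) = scale c (mult w u)"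
    "mult 0 w = 0" "mult w 0 = 0"
    by (fact l.add r.add l.scale r.scale l.zero r.zero)+
qed

lemma form_skew: "form v u = - form u v"
proof -
  have "form (u + v) (u + v) = form u v + form v u"
    using form_alternating[of u] form_alternating[of v] by (simp add: form_simps)
  then show ?thesis
    by (simp add: form_alternating eq_neg_iff_add_eq_0 add.commute)
qed

lemma mult_skew: "mult v u = - mult u v"
proof -
  have "mult (u + v) (u + v) = mult u v + mult v u"
    using mult_alternating[of u] mult_alternating[of v] by (simp add: mult_simps)
  then show ?thesis
    by (simp add: mult_alternating eq_neg_iff_add_eq_0 add.commute)
qed

text \<open>A cyclic shift turns both sides into a product of \<open>v\<close> and \<open>w\<close>
  paired with \<open>u\<close>, where \<open>mult_skew\<close> gives the sign.\<close>

lemma form_mult_swap: "form (mult u v) w = - form (mult u w) v"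
  using form_mult_cyclic[of u v w] form_mult_cyclic[of u w v] mult_skew[of w v]
  by (simp add: form_simps)

text \<open>Right multiplication by \<open>w\<close> is self-adjoint for the form. This is what
  carries ideals and central steps over to orthogonal complements.\<close>

lemma form_mult_right: "form u (mult v w) = form (mult u w) v"
  using form_skew[of u "mult v w"] form_mult_cyclic[of u v w] form_mult_swap[of u v w]
  by (metis minus_minus)

section \<open>Orthogonal complements and dimension\<close>

lemma subspace_perp: "subspace (perp U)"
  by (auto simp: perp_def subspace_def form_simps)

lemma perp_antimono: "U \<subseteq> V \<Longrightarrow> perp V \<subseteq> perp U"
  by (auto simp: perp_def)

lemma subset_perp_perp: "U \<subseteq> perp (perp U)"
  by (auto simp: perp_def) (metis form_skew neg_equal_0_iff_equal)

lemma isotropic_iff: "isotropic U \<longleftrightarrow> subspace U \<and> U \<subseteq> perp U"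
  by (auto simp: isotropic_def perp_def)

lemma in_perp_span: "(\<And>u. u \<in> U \<Longrightarrow> form u v = 0) \<Longrightarrow> v \<in> perp (span U)"
proof -
  assume *: "\<And>u. u \<in> U \<Longrightarrow> form u v = 0"
  have "subspace {u. form u v = 0}" by (auto simp: subspace_def form_simps)
  then have "span U \<subseteq> {u. form u v = 0}" using * by (intro span_minimal) auto
  then show ?thesis by (auto simp: perp_def)
qed

text \<open>The locale asserts only that some finite basis exists, so finite-dimensional facts are
  reached by an interpretation inside a proof. This lemma and the next two export them to the
  locale.\<close>

lemma dim_mono_subset: "U \<subseteq> V \<Longrightarrow> dim U \<le> dim V"
proof -
  obtain B where "finite_dimensional_vector_space scale B" using finite_dim ..
  then interpret finite_dimensional_vector_space scale B .
  show "U \<subseteq> V \<Longrightarrow> dim U \<le> dim V" by (rule dim_subset)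
qed

lemma subspace_eqI_dim:
  "subspace U \<Longrightarrow> subspace V \<Longrightarrow> U \<subseteq> V \<Longrightarrow> dim V \<le> dim U \<Longrightarrow> U = V"
proof -
  obtain B where "finite_dimensional_vector_space scale B" using finite_dim ..
  then interpret finite_dimensional_vector_space scale B .
  show "subspace U \<Longrightarrow> subspace V \<Longrightarrow> U \<subseteq> V \<Longrightarrow> dim V \<le> dim U \<Longrightarrow> U = V"
    by (rule subspace_dim_equal)
qed

lemma dim_span_insert: "subspace U \<Longrightarrow> v \<notin> U \<Longrightarrow> dim (span (insert v U)) = Suc (dim U)"
proof -
  obtain B where "finite_dimensional_vector_space scale B" using finite_dim ..
  then interpret finite_dimensional_vector_space scale B .
  show "subspace U \<Longrightarrow> v \<notin> U \<Longrightarrow> dim (span (insert v U)) = Suc (dim U)"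
    by (simp add: dim_insert span_eq_iff[THEN iffD2])
qed

lemma in_span_insertE:
  assumes "subspace U" "x \<in> span (insert v U)"
  obtains u k where "u \<in> U" "x = u + scale k v"
proof -
  obtain k where "x - scale k v \<in> U"
    using assms by (auto simp: span_breakdown_eq span_eq_iff[THEN iffD2])
  then show thesis using that[of "x - scale k v" k] by simp
qed

text \<open>With a basis \<open>C\<close> of \<open>U\<close> extended to a basis \<open>D\<close> of \<open>L\<close>, the map \<open>v \<mapsto> \<Sum>b\<in>D. (v, b) b\<close> is an
  automorphism taking \<open>U\<^sup>\<bottom>\<close> to the span of \<open>D - C\<close>.\<close>

lemma dim_perp:
  assumes U: "subspace U"
  shows "dim (perp U) + dim U = dim UNIV"
proof -
  obtain B where "finite_dimensional_vector_space scale B" using finite_dim ..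
  then interpret fd: finite_dimensional_vector_space scale B .
  interpret p: finite_dimensional_vector_space_pair_1 scale B scale by unfold_locales
  obtain C where C: "C \<subseteq> U" "independent C" "U \<subseteq> span C" "card C = dim U"
    by (rule basis_exists)
  obtain D where D: "C \<subseteq> D" "independent D" "UNIV \<subseteq> span D"
    using maximal_independent_subset_extend[OF subset_UNIV C(2)] by metis
  have fin: "finite D" by (rule fd.finiteI_independent[OF D(2)])
  define T where "T v = (\<Sum>b\<in>D. scale (form v b) b)" for v
  have lin: "Vector_Spaces.linear scale scale T"
    unfolding Vector_Spaces.linear_iff T_def using vector_space_axioms
    by (simp add: form_simps scale_left_distrib sum.distrib scale_sum_right)
  interpret T: Vector_Spaces.linear scale scale T by (rule lin)
  have spanU: "span C = U"
    using C(1,3) U by (metis span_minimal subset_antisym)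
  have coeff: "g b = 0" if "(\<Sum>b\<in>D. scale (g b) b) = 0" "b \<in> D" for g b
    using independentD[OF D(2) fin order_refl that] .
  have inj: "inj T"
  proof (rule T.inj_iff_eq_0[THEN iffD2], intro allI impI)
    fix v assume "T v = 0"
    then have "form v b = 0" if "b \<in> D" for b
      using coeff[of "form v"] that by (simp add: T_def)
    then have "v \<in> perp (span D)"
      by (intro in_perp_span) (metis form_skew neg_equal_0_iff_equal)
    then have "form v w = 0" for w
      using D(3) by (auto simp: perp_def) (metis form_skew neg_equal_0_iff_equal UNIV_I subsetD)
    then show "v = 0" by (rule form_nondegenerate)
  qed
  have surj: "surj T" by (rule fd.linear_inj_imp_surj[OF lin inj])
  have "T ` perp U = span (D - C)"
  proof (intro subset_antisym subsetI)
    fix x assume "x \<in> T ` perp U"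
    then obtain v where v: "v \<in> perp U" "x = T v" by auto
    have "form v b = 0" if "b \<in> C" for b
      using v(1) C(1) that by (auto simp: perp_def) (metis form_skew neg_equal_0_iff_equal subsetD)
    then have "x = (\<Sum>b\<in>D - C. scale (form v b) b)"
      unfolding v(2) T_def by (intro sum.mono_neutral_right) (auto simp: fin)
    then show "x \<in> span (D - C)"
      by (auto intro: span_sum span_scale span_base)
  next
    fix x assume "x \<in> span (D - C)"
    then obtain g where g: "x = (\<Sum>b\<in>D - C. scale (g b) b)"
      using span_finite[of "D - C"] fin by auto
    obtain v where v: "x = T v" using surj by (metis surjD)
    \<comment> \<open>The coefficients of \<open>x\<close> are extended by 0 over \<open>C\<close>;
      comparing them with those of \<open>T v\<close> through independence of \<open>D\<close> makes
      \<open>v\<close> orthogonal to \<open>C\<close>.\<close>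
    have x': "x = (\<Sum>b\<in>D. scale (if b \<in> C then 0 else g b) b)"
      unfolding g by (rule sum.mono_neutral_cong_left) (auto simp: fin)
    have "(\<Sum>b\<in>D. scale (form v b - (if b \<in> C then 0 else g b)) b) = 0"
      using v x' by (simp add: T_def scale_left_diff_distrib sum_subtractf)
    from coeff[OF this] have "form v b = 0" if "b \<in> C" for b
      using that D(1) by force
    then have "v \<in> perp (span C)"
      by (intro in_perp_span) (metis form_skew neg_equal_0_iff_equal)
    then show "x \<in> T ` perp U" using v spanU by auto
  qed
  then have "dim (perp U) = dim (span (D - C))"
    using p.dim_image_eq[OF lin, of "perp U"] inj by (metis inj_on_subset subset_UNIV)
  also have "\<dots> = card (D - C)"
    by (rule dim_span_eq_card_independent) (metis D(2) Diff_subset independent_mono)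
  also have "\<dots> = card D - card C" by (meson D(1) card_Diff_subset fin finite_subset)
  also have "card D = dim UNIV" by (rule basis_card_eq_dim) (use D in auto)
  finally show ?thesis
    using C(4) dim_mono_subset[of U UNIV] by simp
qed

text \<open>The dimension formula, applied to \<open>U\<close> and to \<open>perp U\<close>, gives
  both sides the same dimension, so the easy inclusion is an equality.\<close>

lemma perp_perp: "subspace U \<Longrightarrow> perp (perp U) = U"
  using dim_perp[of U] dim_perp[of "perp U"] subspace_perp
  by (intro subspace_eqI_dim[symmetric] subset_perp_perp) simp_all

lemma perp_strict_antimono:
  "subspace U \<Longrightarrow> subspace V \<Longrightarrow> U \<subset> V \<Longrightarrow> perp V \<subset> perp U"
  by (metis perp_antimono perp_perp psubset_eq)

section \<open>Ideals, central steps and their duals\<close>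

lemma subspace_prod_subset_iff:
  "subspace W \<Longrightarrow> subspace_prod U V \<subseteq> W \<longleftrightarrow> (\<forall>u\<in>U. \<forall>v\<in>V. mult u v \<in> W)"
proof
  assume "subspace_prod U V \<subseteq> W"
  then show "\<forall>u\<in>U. \<forall>v\<in>V. mult u v \<in> W"
    unfolding subspace_prod_def by (blast intro: span_base)
next
  assume "subspace W" "\<forall>u\<in>U. \<forall>v\<in>V. mult u v \<in> W"
  then show "subspace_prod U V \<subseteq> W"
    unfolding subspace_prod_def by (intro span_minimal) auto
qed

lemma ideal_iff: "ideal I \<longleftrightarrow> subspace I \<and> (\<forall>u\<in>I. \<forall>v. mult u v \<in> I)"
  unfolding ideal_def using subspace_prod_subset_iff[of I I UNIV] by auto

lemma ideal_0: "ideal {0}" and ideal_UNIV: "ideal UNIV"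
  by (auto simp: ideal_iff mult_simps)

lemma ideal_perp: "ideal I \<Longrightarrow> ideal (perp I)"
proof -
  assume I: "ideal I"
  have "form u (mult v w) = 0" if "u \<in> I" "v \<in> perp I" for u v w
  proof -
    have "mult u w \<in> I" using I that(1) by (simp add: ideal_iff)
    then have "form (mult u w) v = 0" using that(2) by (simp add: perp_def)
    then show ?thesis
      by (simp add: form_mult_right)
  qed
  then have "mult v w \<in> perp I" if "v \<in> perp I" for v w
    using that by (simp add: perp_def[of I])
  then show ?thesis by (simp add: ideal_iff subspace_perp)
qed

text \<open>Dualises a central step: \<open>(a, y x) = (a x, y)\<close> by self-adjointness, and
  \<open>a x\<close> lies in \<open>I\<close>.\<close>

lemma subspace_prod_perp_subset:
  assumes "subspace J" "subspace_prod J UNIV \<subseteq> I" "subspace I"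
  shows "subspace_prod (perp I) UNIV \<subseteq> perp J"
proof -
  have "form a (mult y x) = 0" if "a \<in> J" "y \<in> perp I" for a x y
  proof -
    have "mult a x \<in> I" using assms that(1) by (simp add: subspace_prod_subset_iff)
    then have "form (mult a x) y = 0" using that(2) by (simp add: perp_def)
    then show ?thesis
      by (simp add: form_mult_right)
  qed
  then have "mult y x \<in> perp J" if "y \<in> perp I" for x y
    using that by (simp add: perp_def[of J])
  then show ?thesis by (simp add: subspace_prod_subset_iff subspace_perp)
qed

section \<open>Construction of the isotropic flag\<close>

text \<open>In the quotient by \<open>I\<close>, a nonzero ideal of a nilpotent algebra contains a
  nonzero element that annihilates everything.\<close>

lemma nilpotent_central_mod:
  assumes nil: nilpotent and I: "ideal I" and J: "ideal J" and not: "\<not> J \<subseteq> I"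
  obtains v where "v \<in> J" "v \<notin> I" "\<And>x. mult v x \<in> I"
proof -
  obtain m Js where Js: "full_central_chain m Js"
    using nil unfolding nilpotent_def by blast
  define P where "P s \<longleftrightarrow> s \<le> m \<and> \<not> Js ! s \<inter> J \<subseteq> I" for s
  have "P m" using Js not by (auto simp: P_def full_central_chain_def)
  define s where "s = (LEAST s. P s)"
  have s: "P s" unfolding s_def using \<open>P m\<close> by (rule LeastI)
  have "0 \<in> I" using I by (simp add: ideal_iff subspace_0)
  \<comment> \<open>The chain starts at \<open>{0}\<close>, which lies in \<open>I\<close>, so the
    least index \<open>s\<close> has a predecessor \<open>t\<close>.\<close>
  then have "\<not> P 0" using Js by (auto simp: P_def full_central_chain_def)
  then obtain t where t: "s = Suc t" using s by (cases s) auto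
  have "\<not> P t" using not_less_Least[of t P] t s_def by simp
  then have tI: "Js ! t \<inter> J \<subseteq> I" using s t by (auto simp: P_def)
  have len: "Suc t < length Js" using s t Js by (auto simp: P_def full_central_chain_def)
  have cc: "central_chain Js" using Js by (simp add: full_central_chain_def)
  then have step: "subspace_prod (Js ! Suc t) UNIV \<subseteq> Js ! t"
    using len by (auto simp: central_chain_def successively_conv_nth)
  have "ideal (Js ! t)" using cc len by (simp add: central_chain_def)
  then have step: "mult u x \<in> Js ! t" if "u \<in> Js ! s" for u x
    using step that t by (simp add: subspace_prod_subset_iff ideal_iff)
  obtain v where v: "v \<in> Js ! s" "v \<in> J" "v \<notin> I" using s by (auto simp: P_def)
  show thesis
  proof (rule that)
    \<comment> \<open>The product stays in the ideal \<open>J\<close> and drops to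
      \<open>Js ! t\<close>; by minimality of \<open>s\<close> the two meet inside
      \<open>I\<close>.\<close>
    show "mult v x \<in> I" for x
      using step[OF v(1)] tI J v(2) by (auto simp: ideal_iff)
  qed (use v in auto)
qed

lemma isotropic_ideal_extend:
  assumes nil: nilpotent and I: "ideal I" and iso: "isotropic I" and dimI: "2 * dim I < dim UNIV"
  obtains J where "ideal J" "isotropic J" "dim J = Suc (dim I)" "I \<subset> J"
    "subspace_prod J UNIV \<subseteq> I"
proof -
  have sub: "subspace I" using I by (simp add: ideal_iff)
  \<comment> \<open>Otherwise \<open>dim (perp I) \<le> dim I\<close>, although the two dimensions
    add up to more than \<open>2 * dim I\<close>.\<close>
  have "\<not> perp I \<subseteq> I"
    using dim_mono_subset[of "perp I" I] dim_perp[OF sub] dimI by auto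
  then obtain v where v: "v \<in> perp I" "v \<notin> I" "\<And>x. mult v x \<in> I"
    using nilpotent_central_mod[OF nil I ideal_perp[OF I]] by metis
  define J where "J = span (insert v I)"
  have IJ: "I \<subseteq> J" "v \<in> J" by (auto simp: J_def intro: span_base)
  have prod: "mult u x \<in> I" if u: "u \<in> J" for u x
  proof -
    obtain w k where "w \<in> I" "u = w + scale k v"
      using u unfolding J_def by (rule in_span_insertE[OF sub])
    then show ?thesis
      using v(3)[of x] I by (auto simp: ideal_iff mult_simps intro: subspace_add subspace_scale)
  qed
  have subJ: "subspace J" by (simp add: J_def)
  have vJ: "v \<in> perp J"
    unfolding J_def using v(1) by (intro in_perp_span) (auto simp: form_alternating perp_def)
  have IpJ: "w \<in> perp J" if "w \<in> I" for w
    unfolding J_def using v(1) that iso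
    by (intro in_perp_span) (auto simp: perp_def isotropic_def form_skew[of _ v])
  show thesis
  proof (rule that)
    show "ideal J" using prod IJ subJ by (auto simp: ideal_iff)
    have "J \<subseteq> perp J"
      unfolding J_def by (rule span_minimal) (use vJ IpJ subspace_perp in \<open>auto simp: J_def\<close>)
    then show "isotropic J" using subJ by (simp add: isotropic_iff)
    show "dim J = Suc (dim I)" using dim_span_insert[OF sub v(2)] by (simp add: J_def)
    show "I \<subset> J" using IJ v(2) by auto
    show "subspace_prod J UNIV \<subseteq> I" using prod sub by (simp add: subspace_prod_subset_iff)
  qed
qed

lemma isotropic_flag_exists:
  assumes nil: nilpotent and dimL: "dim UNIV = 2 * n"
  obtains I where "I 0 = {0}" "\<And>r. r \<le> n \<Longrightarrow> ideal (I r) \<and> isotropic (I r) \<and> dim (I r) = r"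
    "\<And>r. r < n \<Longrightarrow> I r \<subset> I (Suc r) \<and> subspace_prod (I (Suc r)) UNIV \<subseteq> I r"
proof -
  \<comment> \<open>Beyond \<open>n\<close> both \<open>P\<close> and \<open>Q\<close> hold
    vacuously, so that dependent choice finds a successor at every index.\<close>
  define P where "P r I \<longleftrightarrow> (r = 0 \<longrightarrow> I = {0}) \<and> (r \<le> n \<longrightarrow> ideal I \<and> isotropic I \<and> dim I = r)"
    for r I
  define Q where "Q r I I' \<longleftrightarrow> (r < n \<longrightarrow> I \<subset> I' \<and> subspace_prod I' UNIV \<subseteq> I)" for r I I'
  have "\<exists>f. \<forall>r. P r (f r) \<and> Q r (f r) (f (Suc r))"
  proof (rule dependent_nat_choice)
    have "dim {0} = 0"
      using dim_le_card[of "{0}" "{}"] by simp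
    then show "\<exists>I. P 0 I"
      by (auto simp: P_def ideal_0 isotropic_def form_simps)
  next
    fix I r assume P: "P r I"
    show "\<exists>J. P (Suc r) J \<and> Q r I J"
    proof (cases "r < n")
      case True
      then have "ideal I" "isotropic I" "dim I = r" "2 * dim I < dim UNIV"
        using P dimL by (auto simp: P_def)
      then obtain J where "ideal J" "isotropic J" "dim J = Suc r" "I \<subset> J"
        "subspace_prod J UNIV \<subseteq> I"
        using isotropic_ideal_extend[OF nil] by metis
      then show ?thesis by (auto simp: P_def Q_def)
    qed (auto simp: P_def Q_def)
  qed
  then obtain f where "\<And>r. P r (f r)" "\<And>r. Q r (f r) (f (Suc r))" by blast
  then show thesis
    by (intro that[of f]) (auto simp: P_def Q_def)
qed

section \<open>The steps saved by the alternating property\<close>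

text \<open>With \<open>I\<close> spanned by \<open>u\<close>, a vector \<open>v\<close> of
  \<open>J\<close> has \<open>mult v x = scale (f x) u\<close>. Then
  \<open>(v x, y) = f x * (u, y)\<close> is an alternating form of rank at most one, hence zero;
  testing against \<open>z\<close> with \<open>(u, z) \<noteq> 0\<close> gives
  \<open>f = 0\<close>.\<close>

lemma dim_2_flag_central:
  assumes I: "subspace I" "dim I = 1" "subspace_prod I UNIV \<subseteq> {0}"
    and J: "subspace J" "dim J = 2" "subspace_prod J UNIV \<subseteq> I"
  shows "subspace_prod J UNIV \<subseteq> {0}"
proof -
  have "dim {0} = 0" using dim_le_card[of "{0}" "{}"] by simp
  then have "\<not> I \<subseteq> {0}" using I(2) dim_mono_subset[of I "{0}"] by auto
  then obtain u where u: "u \<in> I" "u \<noteq> 0" by auto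
  have "dim (span {u}) = Suc 0"
    using u(2) \<open>dim {0} = 0\<close> dim_span_insert[of "{0}" u] by (simp add: insert_commute)
  then have "span {u} = I"
    using u I by (intro subspace_eqI_dim span_minimal) auto
  have "mult v x = 0" if "v \<in> J" for v x
  proof -
    have "\<exists>c. mult v x = scale c u" for x
      using that J(3) I(1) \<open>span {u} = I\<close> by (auto simp: subspace_prod_subset_iff span_singleton)
    then obtain f where f: "\<And>x. mult v x = scale (f x) u" by metis
    have skew: "f x * form u y = - (f y * form u x)" for x y
      using form_mult_swap[of v x y] by (simp add: f form_simps)
    have diag: "f x * form u x = 0" for x
      using form_mult_cyclic[of v x x]
      by (simp add: f form_simps mult_alternating)
    obtain z where z: "form u z \<noteq> 0" using u(2) form_nondegenerate by blast
    then have "f z = 0" using diag[of z] by simp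
    then have "f x = 0" using skew[of x z] z by simp
    then show ?thesis by (simp add: f)
  qed
  then show ?thesis by (simp add: subspace_prod_subset_iff)
qed

text \<open>Multiplication by \<open>J\<close> kills \<open>perp I\<close>, and
  \<open>perp I\<close> is \<open>J\<close> plus one line, on which the product vanishes because it
  is alternating.\<close>

lemma perp_abelian:
  assumes I: "ideal I" and J: "isotropic J" "I \<subseteq> J" "subspace_prod J UNIV \<subseteq> I"
    and dimL: "dim UNIV = 2 * dim J" "dim J = Suc (dim I)"
  shows "abelian_ideal (perp I)"
proof -
  have sub: "subspace I" "subspace J" using I J by (auto simp: ideal_iff isotropic_def)
  have JI: "J \<subseteq> perp I" using J perp_antimono[of I J] by (auto simp: isotropic_iff)
  \<comment> \<open>Swapping the last two arguments gives \<open>(x y, z) = - (x z, y)\<close>,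
    which pairs an element of \<open>I\<close> with one of \<open>perp I\<close>.\<close>
  have zero: "mult x y = 0" if "x \<in> J" "y \<in> perp I" for x y
  proof (rule form_nondegenerate)
    fix z
    have "mult x z \<in> I" using that(1) J(3) sub by (simp add: subspace_prod_subset_iff)
    then have "form (mult x z) y = 0" using that(2) by (simp add: perp_def)
    then show "form (mult x y) z = 0" using form_mult_swap[of x y z] by simp
  qed
  have dimI: "dim (perp I) = Suc (dim J)" using dim_perp[OF sub(1)] dimL by simp
  then have "J \<noteq> perp I" by auto
  then obtain y where y: "y \<in> perp I" "y \<notin> J" using JI by auto
  have eq: "span (insert y J) = perp I"
    using y JI dimI dim_span_insert[OF sub(2) y(2)]
    by (intro subspace_eqI_dim span_minimal) (auto simp: subspace_perp)
  have "mult a b = 0" if a: "a \<in> perp I" and b: "b \<in> perp I" for a b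
  proof -
    obtain a' k where "a' \<in> J" "a = a' + scale k y"
      using in_span_insertE[OF sub(2)] a eq by metis
    moreover obtain b' l where "b' \<in> J" "b = b' + scale l y"
      using in_span_insertE[OF sub(2)] b eq by metis
    ultimately show ?thesis
      using zero[of a' b] zero[of b' y] b y(1) mult_skew[of y b']
      by (simp add: mult_simps mult_alternating)
  qed
  then have "subspace_prod (perp I) (perp I) \<subseteq> {0}" by (simp add: subspace_prod_subset_iff)
  moreover have "0 \<in> subspace_prod (perp I) (perp I)"
    unfolding subspace_prod_def by (rule span_zero)
  ultimately show ?thesis using ideal_perp[OF I] unfolding abelian_ideal_def by blast
qed

text \<open>For \<open>y\<close> and \<open>z\<close> in \<open>perp I\<close>,
  \<open>(y x, z) = (z y, x) = 0\<close>, so \<open>y x\<close> lies in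
  \<open>perp (perp I) = I\<close>. This makes the middle of the chain a single central
  step.\<close>

lemma subspace_prod_perp_abelian:
  assumes "subspace I" "abelian_ideal (perp I)"
  shows "subspace_prod (perp I) UNIV \<subseteq> I"
proof -
  have "form z (mult y x) = 0" if "y \<in> perp I" "z \<in> perp I" for x y z
  proof -
    have "mult z y \<in> {0}"
      using assms(2) that subspace_prod_subset_iff[of "{0}" "perp I" "perp I"]
      by (simp add: abelian_ideal_def)
    then have "form (mult y x) z = 0"
      using form_mult_cyclic[of z y x] by (simp add: form_simps)
    then show ?thesis by (simp add: form_skew[of z])
  qed
  then have "subspace_prod (perp I) UNIV \<subseteq> perp (perp I)"
    by (auto simp: subspace_prod_subset_iff subspace_perp) (simp add: perp_def[of "perp I"])
  then show ?thesis using perp_perp[OF assms(1)] by simp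
qed

lemma nilpotence_class_le: "full_central_chain m Js \<Longrightarrow> nilpotence_class \<le> m"
  unfolding nilpotence_class_def by (rule Least_le) blast

end

section \<open>Assembly of the central chain\<close>

lemma successively_uptI:
  "(\<And>i. m \<le> i \<Longrightarrow> Suc i < n \<Longrightarrow> P i (Suc i)) \<Longrightarrow> successively P [m..<n]"
  by (simp add: successively_conv_nth)

theorem theorem2p10:
  fixes scale :: "'f::field \<Rightarrow> 'v::ab_group_add \<Rightarrow> 'v"
    and form :: "'v \<Rightarrow> 'v \<Rightarrow> 'f"
    and mult :: "'v \<Rightarrow> 'v \<Rightarrow> 'v"
    and n :: nat
  assumes "symp_alt_algebra scale form mult"
    and "symp_alt_algebra.nilpotent scale mult"
    and "vector_space.dim scale (UNIV :: 'v set) = 2 * n"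
    and "2 * n \<ge> 2"
  shows "\<exists>I :: nat \<Rightarrow> 'v set.
      I 0 = {0} \<and>
      (\<forall>r<n. I r \<subset> I (Suc r)) \<and>
      (\<forall>r\<le>n. symp_alt_algebra.ideal scale mult (I r) \<and>
             symp_alt_algebra.isotropic scale form (I r) \<and>
             vector_space.dim scale (I r) = r) \<and>
      (2 * n \<ge> 6 \<longrightarrow>
        symp_alt_algebra.abelian_ideal scale mult (symp_alt_algebra.perp form (I (n - 1))) \<and>
        (let Js = [{0}] @ map I [2..<n]
                  @ map (\<lambda>r. symp_alt_algebra.perp form (I r)) (rev [2..<n]) @ [UNIV]
         in sorted_wrt (\<subset>) Js \<and> symp_alt_algebra.central_chain scale mult Js) \<and>
        symp_alt_algebra.nilpotence_class scale mult \<le> 2 * n - 3)"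
proof -
  interpret symp_alt_algebra scale form mult by fact
  obtain I where I0: "I 0 = {0}"
    and I: "\<And>r. r \<le> n \<Longrightarrow> ideal (I r) \<and> isotropic (I r) \<and> dim (I r) = r"
    and step: "\<And>r. r < n \<Longrightarrow> I r \<subset> I (Suc r) \<and> subspace_prod (I (Suc r)) UNIV \<subseteq> I r"
    using isotropic_flag_exists[OF assms(2,3)] by metis
  have sub: "subspace (I r)" if "r \<le> n" for r using I[OF that] by (simp add: ideal_iff)
  define Js where "Js = [{0}] @ map I [2..<n] @ map (\<lambda>r. perp (I r)) (rev [2..<n]) @ [UNIV]"
  have "abelian_ideal (perp (I (n - 1))) \<and> (sorted_wrt (\<subset>) Js \<and> central_chain Js) \<and>
    nilpotence_class \<le> 2 * n - 3" if "2 * n \<ge> 6"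
  proof -
    from that have n: "n \<ge> 3" by simp
    have step': "I (n - 1) \<subset> I n" "subspace_prod (I n) UNIV \<subseteq> I (n - 1)"
      using step[of "n - 1"] n by auto
    have ab: "abelian_ideal (perp (I (n - 1)))"
      using I[of "n - 1"] I[of n] step' n assms(3)
      by (intro perp_abelian[of "I (n - 1)" "I n"]) auto
    \<comment> \<open>Strict inclusion and centrality are joined in one relation, so that a single
      pass over the list yields both the ordering and the central chain.\<close>
    define R where "R J J' \<longleftrightarrow> J \<subset> J' \<and> subspace_prod J' UNIV \<subseteq> J" for J J'
    have mid: "R (I (n - 1)) (perp (I (n - 1)))"
    proof -
      have "I n \<subseteq> perp (I n)" using I[of n] by (simp add: isotropic_iff)
      then have "I (n - 1) \<subset> perp (I (n - 1))"
        using step'(1) perp_antimono[of "I (n - 1)" "I n"] by blast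
      then show ?thesis using subspace_prod_perp_abelian[OF _ ab] sub by (simp add: R_def)
    qed
    have low: "I 0 \<subset> I 1" "subspace_prod (I 1) UNIV \<subseteq> I 0"
      "I 1 \<subset> I 2" "subspace_prod (I 2) UNIV \<subseteq> I 1"
      using step[of 0] step[of 1] n by (simp_all only: One_nat_def numeral_2_eq_2)
    have central: "subspace_prod (I 2) UNIV \<subseteq> {0}"
    proof (rule dim_2_flag_central)
      show "subspace (I 1)" "dim (I 1) = 1" "subspace (I 2)" "dim (I 2) = 2"
        using I[of 1] I[of 2] n by (simp_all add: ideal_iff)
    qed (use low I0 in simp_all)
    have "I 0 \<subset> I 2" using low by blast
    then have bottom: "R {0} (I 2)" using central I0 by (simp add: R_def)
    have p0: "perp {0} = UNIV" by (auto simp: perp_def form_simps)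
    \<comment> \<open>The dual of the bottom step, since \<open>perp {0}\<close> is the whole
      algebra.\<close>
    have top: "R (perp (I 2)) UNIV"
      using perp_strict_antimono[OF sub sub \<open>I 0 \<subset> I 2\<close>] n
        subspace_prod_perp_subset[OF sub central[folded I0] sub] by (simp add: R_def I0 p0)
    have up: "successively R (map I [2..<n])"
      unfolding successively_map by (rule successively_uptI) (use step in \<open>simp add: R_def\<close>)
    have "R (perp (I (Suc r))) (perp (I r))" if "r < n" for r
      using that step[OF that] sub[of r] sub[of "Suc r"]
      by (simp add: R_def perp_strict_antimono subspace_prod_perp_subset)
    then have down: "successively R (map (\<lambda>r. perp (I r)) (rev [2..<n]))"
      unfolding successively_map successively_rev by (intro successively_uptI) simp
    \<comment> \<open>Besides the two inner runs only three joins remain, \<open>bottom\<close>,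
      \<open>mid\<close> and \<open>top\<close>; \<open>n \<ge> 3\<close> makes both runs
      nonempty.\<close>
    have R: "successively R Js"
      unfolding Js_def using up down mid bottom top n
      by (simp add: successively_append_iff successively_Cons hd_map last_map hd_rev last_rev
          hd_append del: successively_rev)
    have "successively (\<subset>) Js"
      using R by (rule successively_mono) (auto simp: R_def)
    then have sorted: "sorted_wrt (\<subset>) Js"
      by (subst (asm) successively_conv_sorted_wrt) (auto simp: transp_def)
    have "successively (\<lambda>J J'. J \<subseteq> J' \<and> subspace_prod J' UNIV \<subseteq> J) Js"
      using R by (rule successively_mono) (auto simp: R_def)
    moreover have "\<forall>J\<in>set Js. ideal J"
      using I ideal_0 ideal_UNIV ideal_perp by (auto simp: Js_def)
    ultimately have cc: "central_chain Js" by (simp add: central_chain_def)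
    have "full_central_chain (2 * n - 3) Js"
    proof -
      \<comment> \<open>There are two end terms and \<open>n - 2\<close> terms in each run, hence
        \<open>2 * n - 2\<close> ideals and one step fewer.\<close>
      have len: "length Js = 2 * n - 3 + 1" using n by (simp add: Js_def)
      have "Js ! (2 * n - 3) = last Js" using len by (subst last_conv_nth) auto
      then show ?thesis using cc len by (simp add: full_central_chain_def Js_def)
    qed
    then show ?thesis using ab sorted cc nilpotence_class_le by blast
  qed
  then show ?thesis
    using I0 I step by (intro exI[of _ I]) (simp add: Js_def)
qed

end
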